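(* For every nonzero integer $k$, the value of $R_k(\sqrt2)$ is given by $$R_k(\sqrt{2}) = \begin{cases} \left\lfloor\tfrac14 (1+\sqrt{2})^{2k+1}\right\rfloor & \text{if } k>0,\\[4pt] \left\lfloor\tfrac14 (1+\sqrt{2})^{-2k}\right\rfloor & \text{if } k<0.\end{cases}$$ In particular, there are infinitely many positive integers $N$ with $$|S_N(\sqrt{2})| > \frac{\log (4N)}{2\log(1+\sqrt{2})} > \frac{\log N}{2\log(1+\sqrt{2})} + 0.78.$$
   Context: For a real number $\alpha$ and an integer $N\ge 0$, $S_N(\alpha) := \sum_{n=1}^N (-1)^{\lfloor n\alpha\rfloor}$, where $\lfloor x\rfloor$ is the greatest integer not larger than $x$. For an integer $k$, the record-holder at $k$ is $R_k(\alpha)=\min\{N\ge 0 : S_N(\alpha)=k\}$ ($N$ ranging over integers). $\log$ is the natural logarithm. *)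

theory Defs
  imports Complex_Main
begin

definition S :: "nat \<Rightarrow> real \<Rightarrow> real" where
  "S N \<alpha> = (\<Sum>n=1..N. (-1) powi \<lfloor>real n * \<alpha>\<rfloor>)"

(* If k is not attained by N \<mapsto> S N \<alpha>, the minimum does not exist and LEAST returns an
   unspecified value; a statement about a value of R should therefore also assert that k is attained. *)
definition R :: "int \<Rightarrow> real \<Rightarrow> nat" where
  "R k \<alpha> = (LEAST N. S N \<alpha> = of_int k)"

end

theory Submission
  imports Defs
begin

text \<open>
  Write \<open>w = 1 + sqrt 2\<close> and \<open>\<theta> = sqrt 2 - 1\<close>, so that \<open>w * \<theta> = 1\<close>. The proof rests on the fact
  that the walk \<open>N \<mapsto> S N (sqrt 2)\<close> is self-similar, because \<open>w = 2 + 1 / w\<close>.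

  The \<open>n\<close>-th step of the walk is \<open>(-1)^(n + \<lfloor>n * \<theta>\<rfloor>)\<close>. As long as \<open>\<lfloor>n * \<theta>\<rfloor>\<close> keeps the value \<open>m\<close>,
  that is for \<open>\<lfloor>m * w\<rfloor> < n \<le> \<lfloor>(m + 1) * w\<rfloor>\<close>, the steps simply alternate. Such a block has two or
  three steps. A block of two steps cancels, and a block of three steps contributes the opposite of
  step \<open>m\<close>; reading off when the long blocks occur shows that the walk at time
  \<open>\<lfloor>m * w\<rfloor>\<close> has the same position as at time \<open>\<lfloor>m * \<theta>\<rfloor>\<close> (lemma \<open>walk_expand\<close>). Hence
  every position in block \<open>m\<close> is at most one step away from the position at the
  much earlier time \<open>\<lfloor>m * \<theta>\<rfloor>\<close>. A record at time \<open>J\<close> therefore cannot be improved before the first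
  block \<open>M\<close> with \<open>\<lfloor>M * \<theta>\<rfloor> = J\<close> that starts in the right direction, and it is improved by the first
  step of that block. This yields the next record time as
  \<open>\<lfloor>w * (\<lfloor>w * J\<rfloor> + 1)\<rfloor> + 1\<close> (lemma \<open>record_step\<close>).

  Iterating \<open>J \<mapsto> \<lfloor>w * J\<rfloor> + 1\<close> from \<open>0\<close> gives the sequence \<open>0, 1, 3, 8, 20, 49, \<dots>\<close>, whose
  even-indexed members are the records of the nonnegative values and whose odd-indexed members are those
  of the negative values. It satisfies a Pell type recurrence, whose solution is the closed form of
  the statement. The logarithmic bound holds at every record of a negative value: there
  \<open>4 * N < w^(2 * \<bar>k\<bar>)\<close>, and the constant \<open>0.78\<close> comes from \<open>w^39 < 4^25\<close>.
\<close>

section \<open>The two Beatty maps\<close>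

definition shrink :: "nat \<Rightarrow> nat" where
  "shrink n = nat \<lfloor>real n * (sqrt 2 - 1)\<rfloor>"

text \<open>This is \<open>\<lfloor>m * (1 + sqrt 2)\<rfloor>\<close>; writing it through \<^const>\<open>shrink\<close> exposes its parity, on which
  the directions of the steps depend.\<close>

definition expand :: "nat \<Rightarrow> nat" where
  "expand m = 2 * m + shrink m"

lemma real_shrink_le: "real (shrink n) \<le> real n * (sqrt 2 - 1)"
  and less_real_shrink: "real n * (sqrt 2 - 1) < real (shrink n) + 1"
proof -
  have "0 \<le> real n * (sqrt 2 - 1)" by simp
  then have "real (shrink n) = of_int \<lfloor>real n * (sqrt 2 - 1)\<rfloor>"
    unfolding shrink_def by simp
  then show "real (shrink n) \<le> real n * (sqrt 2 - 1)" "real n * (sqrt 2 - 1) < real (shrink n) + 1"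
    by linarith+
qed

lemma real_expand_le: "real (expand m) \<le> real m * (1 + sqrt 2)"
  and less_real_expand: "real m * (1 + sqrt 2) < real (expand m) + 1"
  using real_shrink_le[of m] less_real_shrink[of m] by (simp_all add: expand_def algebra_simps)

lemma le_shrink_iff_real: "m \<le> shrink n \<longleftrightarrow> real m \<le> real n * (sqrt 2 - 1)"
proof
  assume "m \<le> shrink n"
  then show "real m \<le> real n * (sqrt 2 - 1)" using real_shrink_le[of n] by linarith
next
  assume "real m \<le> real n * (sqrt 2 - 1)"
  then have "real m < real (shrink n) + 1" using less_real_shrink[of n] by linarith
  then show "m \<le> shrink n" by linarith
qed

lemma shrink_0 [simp]: "shrink 0 = 0"
  by (simp add: shrink_def)

lemma expand_0 [simp]: "expand 0 = 0"
  by (simp add: expand_def)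

lemma sqrt2_bounds: "sqrt 2 > (7 / 5 :: real)" "sqrt 2 < (71 / 50 :: real)"
  by (rule real_less_rsqrt real_less_lsqrt; simp add: power2_eq_square)+

lemma shrink_Suc: "shrink (Suc n) = shrink n \<or> shrink (Suc n) = Suc (shrink n)"
proof -
  have "real (shrink n) < real (shrink (Suc n)) + 1" "real (shrink (Suc n)) < real (shrink n) + 2"
    using real_shrink_le[of n] less_real_shrink[of n] real_shrink_le[of "Suc n"]
      less_real_shrink[of "Suc n"] sqrt2_bounds by (simp_all add: algebra_simps)
  then show ?thesis by linarith
qed

lemma strict_mono_expand: "strict_mono expand"
proof (rule strict_mono_Suc_iff[THEN iffD2], rule allI)
  show "expand n < expand (Suc n)" for n
    using shrink_Suc[of n] by (auto simp: expand_def)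
qed

text \<open>The irrationality of \<open>sqrt 2\<close>, by infinite descent.\<close>

lemma square_eq_twice_square:
  fixes a b :: nat
  assumes "a * a = 2 * (b * b)"
  shows "b = 0"
  using assms
proof (induction a arbitrary: b rule: less_induct)
  case (less a)
  show ?case
  proof (rule ccontr)
    assume b: "b \<noteq> 0"
    have "even (a * a)" using less.prems by simp
    then obtain c where c: "a = 2 * c" by auto
    have eq: "b * b = 2 * (c * c)" using less.prems c by simp
    have "b < a"
    proof (rule ccontr)
      assume "\<not> b < a"
      then have "a * a \<le> b * b" by (simp add: mult_le_mono)
      with less.prems b show False by simp
    qed
    from less.IH[OF this eq] eq b show False by simp
  qed
qed

lemma multiple_neq_nat:
  assumes "0 < m"
  shows "real m * (1 + sqrt 2) \<noteq> real n"
proof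
  assume eq: "real m * (1 + sqrt 2) = real n"
  moreover have "real m \<le> real m * (1 + sqrt 2)" by (simp add: algebra_simps)
  ultimately have "m \<le> n" by simp
  then obtain d where d: "n = m + d" by (auto simp: le_iff_add)
  with eq have "real m * sqrt 2 = real d" by (simp add: algebra_simps)
  then have "real d * real d = (real m * sqrt 2) * (real m * sqrt 2)" by simp
  also have "\<dots> = 2 * (real m * real m)" by (simp add: ac_simps)
  finally have "real (d * d) = real (2 * (m * m))" by simp
  then have "d * d = 2 * (m * m)" by (simp only: of_nat_eq_iff)
  from square_eq_twice_square[OF this] assms show False by simp
qed

text \<open>\<^const>\<open>shrink\<close> and \<^const>\<open>expand\<close> multiply by the mutually inverse numbers \<open>sqrt 2 - 1\<close> and
  \<open>1 + sqrt 2\<close>, and are therefore adjoint up to rounding; the inequality on the right is strict by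
  irrationality. The equivalence locates the blocks on which \<^const>\<open>shrink\<close> is constant.\<close>

lemma le_shrink_iff:
  assumes "0 < m"
  shows "m \<le> shrink n \<longleftrightarrow> expand m < n"
proof -
  have inv: "(sqrt 2 - 1) * (1 + sqrt 2) = (1::real)" by (simp add: algebra_simps)
  have "m \<le> shrink n \<longleftrightarrow> real m \<le> real n * (sqrt 2 - 1)" by (rule le_shrink_iff_real)
  also have "\<dots> \<longleftrightarrow> real m * (1 + sqrt 2) \<le> real n * (sqrt 2 - 1) * (1 + sqrt 2)"
    by (simp add: add_pos_nonneg)
  also have "real n * (sqrt 2 - 1) * (1 + sqrt 2) = real n"
    unfolding mult.assoc inv by simp
  also have "real m * (1 + sqrt 2) \<le> real n \<longleftrightarrow> real m * (1 + sqrt 2) < real n"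
    using multiple_neq_nat[OF assms, of n] by linarith
  also have "\<dots> \<longleftrightarrow> expand m < n"
    using real_expand_le[of m] less_real_expand[of m] by linarith
  finally show ?thesis .
qed

lemma shrink_eqI:
  assumes "expand m < n" "n \<le> expand (Suc m)"
  shows "shrink n = m"
proof -
  have "m \<le> shrink n" using assms(1) le_shrink_iff[of m n] by (cases "m = 0") auto
  moreover have "\<not> Suc m \<le> shrink n" using assms(2) le_shrink_iff[of "Suc m" n] by simp
  ultimately show ?thesis by simp
qed

lemma expand_shrink_less: "0 < n \<Longrightarrow> expand (shrink n) < n"
  using le_shrink_iff[of "shrink n" n] by (cases "shrink n = 0") auto

lemma le_expand_Suc_shrink: "n \<le> expand (Suc (shrink n))"
  using le_shrink_iff[of "Suc (shrink n)" n] by simp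

lemma shrink_expand_Suc: "shrink (expand (Suc m)) = m"
  by (rule shrink_eqI) (simp_all add: strict_mono_less[OF strict_mono_expand])

lemma expand_Suc_ge: "expand m + 2 \<le> expand (Suc m)"
  using shrink_Suc[of m] by (auto simp: expand_def)

lemma shrink_Suc_expand: "shrink (Suc (expand m)) = m"
  using expand_Suc_ge[of m] by (intro shrink_eqI) simp_all

lemma shrink_Suc_Suc_expand: "shrink (Suc (Suc (expand m))) = m"
  using expand_Suc_ge[of m] by (intro shrink_eqI) simp_all

section \<open>Self-similarity of the walk\<close>

abbreviation walk :: "nat \<Rightarrow> real" where
  "walk N \<equiv> S N (sqrt 2)"

definition dir :: "nat \<Rightarrow> real" where
  "dir n = (-1) ^ (n + shrink n)"

lemma walk_0: "walk 0 = 0"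
  by (simp add: S_def)

lemma walk_Suc: "walk (Suc n) = walk n + dir (Suc n)"
proof -
  have "\<lfloor>real k * sqrt 2\<rfloor> = int (k + shrink k)" for k
    using real_shrink_le[of k] less_real_shrink[of k] by (intro floor_unique) (simp_all add: algebra_simps)
  then show ?thesis by (simp add: S_def dir_def del: of_nat_Suc of_nat_add)
qed

lemma dir_0 [simp]: "dir 0 = 1"
  by (simp add: dir_def)

lemma dir_cases: "dir n = 1 \<or> dir n = -1"
  by (simp add: dir_def minus_one_power_iff)

lemma dir_first: "dir (Suc (expand m)) = - dir m"
proof -
  have "dir (Suc (expand m)) = (-1) ^ (2 * m + 1 + (m + shrink m))"
    unfolding dir_def shrink_Suc_expand by (simp add: expand_def ac_simps)
  then show ?thesis by (simp only: power_add) (simp add: dir_def power_add)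
qed

lemma dir_second: "dir (Suc (Suc (expand m))) = dir m"
proof -
  have "dir (Suc (Suc (expand m))) = - dir (Suc (expand m))"
    unfolding dir_def shrink_Suc_expand shrink_Suc_Suc_expand by simp
  then show ?thesis by (simp add: dir_first)
qed

text \<open>A block of three steps ends exactly where \<^const>\<open>shrink\<close> jumps, say to \<open>j\<close> on passing from
  \<open>m\<close> to \<open>m + 1\<close>. Then \<open>m = expand j\<close>, and the contribution \<open>- dir m\<close> of the block is \<open>dir j\<close>: the
  long blocks replay the steps of the walk in order.\<close>

lemma dir_third:
  assumes "shrink (Suc m) = Suc (shrink m)"
  shows "dir (Suc (Suc (Suc (expand m)))) = - dir m" and "dir (Suc (shrink m)) = - dir m"
proof -
  have "expand (Suc m) = Suc (Suc (Suc (expand m)))"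
    using assms by (simp add: expand_def)
  then have "shrink (Suc (Suc (Suc (expand m)))) = m"
    using shrink_expand_Suc[of m] by simp
  then have "dir (Suc (Suc (Suc (expand m)))) = - dir (Suc (Suc (expand m)))"
    unfolding dir_def shrink_Suc_Suc_expand by simp
  then show "dir (Suc (Suc (Suc (expand m)))) = - dir m" by (simp add: dir_second)
  have "expand (Suc (shrink m)) = m"
    using le_shrink_iff[of "Suc (shrink m)" "Suc m"] le_expand_Suc_shrink[of m] assms by simp
  then have "dir m = dir (expand (Suc (shrink m)))" by simp
  also have "\<dots> = (-1) ^ (expand (Suc (shrink m)) + shrink m)"
    unfolding dir_def shrink_expand_Suc by simp
  also have "\<dots> = - dir (Suc (shrink m))"
    by (simp add: dir_def expand_def power_add power_mult)
  finally show "dir (Suc (shrink m)) = - dir m" by simp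
qed

lemma walk_expand: "walk (expand m) = walk (shrink m)"
proof (induction m)
  case 0
  show ?case by simp
next
  case (Suc m)
  consider "shrink (Suc m) = shrink m" | "shrink (Suc m) = Suc (shrink m)"
    using shrink_Suc by blast
  then show ?case
  proof cases
    case 1
    then have "expand (Suc m) = Suc (Suc (expand m))" by (simp add: expand_def)
    then show ?thesis using 1 Suc by (simp add: walk_Suc dir_first dir_second)
  next
    case 2
    then have "expand (Suc m) = Suc (Suc (Suc (expand m)))" by (simp add: expand_def)
    then show ?thesis using 2 Suc dir_third[OF 2] by (simp add: walk_Suc dir_first dir_second)
  qed
qed

lemma walk_in_block:
  assumes "0 < n"
  shows "walk n = walk (shrink (shrink n)) \<or> walk n = walk (shrink (shrink n)) - dir (shrink n)"
proof -
  let ?m = "shrink n"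
  have "expand ?m < n" "n \<le> expand (Suc ?m)" "expand (Suc ?m) \<le> expand ?m + 3"
    using expand_shrink_less[OF assms] le_expand_Suc_shrink[of n] shrink_Suc[of ?m]
    by (auto simp: expand_def)
  then consider "n = Suc (expand ?m)" | "n = Suc (Suc (expand ?m))"
    | "n = expand (Suc ?m)" "expand (Suc ?m) = Suc (Suc (Suc (expand ?m)))"
    by linarith
  then show ?thesis
  proof cases
    case 1
    then have "walk n = walk (Suc (expand ?m))" by (rule arg_cong)
    then show ?thesis by (simp add: walk_Suc dir_first walk_expand)
  next
    case 2
    then have "walk n = walk (Suc (Suc (expand ?m)))" by (rule arg_cong)
    then show ?thesis by (simp add: walk_Suc dir_first dir_second walk_expand)
  next
    case 3
    then have long: "shrink (Suc ?m) = Suc (shrink ?m)" by (simp add: expand_def)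
    have "walk n = walk (Suc (Suc (Suc (expand ?m))))" using 3 by (intro arg_cong[where f = walk]) simp
    then show ?thesis
      using dir_third(1)[OF long] by (simp add: walk_Suc dir_first dir_second walk_expand)
  qed
qed

section \<open>Record times\<close>

text \<open>The sign \<open>s\<close> treats maxima (\<open>s = 1\<close>) and minima (\<open>s = -1\<close>) at once. The condition
  \<open>dir J = s\<close> says that the walk arrives at the record in direction \<open>s\<close>; at \<open>J = 0\<close>, where no step
  precedes, \<open>dir 0 = 1\<close> makes time \<open>0\<close> a starting point for the maxima but not for the minima.\<close>

definition record_at :: "real \<Rightarrow> nat \<Rightarrow> nat \<Rightarrow> bool" where
  "record_at s k J \<longleftrightarrow> dir J = s \<and> s * walk J = real k \<and> (\<forall>i<J. s * walk i < real k)"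

text \<open>The block \<open>M = expand J + 1\<close> is the first one with \<open>shrink M = J\<close>, except that for \<open>J = 0\<close>
  block \<open>0\<close> precedes it, and its first step goes in the direction \<open>- dir M = dir J = s\<close>. In the
  blocks \<open>m\<close> with \<open>shrink m < J\<close> the position is within one step of a position strictly below the
  record, so the value \<open>k + 1\<close> is out of reach.\<close>

lemma record_step:
  assumes rec: "record_at s k J"
  shows "record_at s (Suc k) (Suc (expand (Suc (expand J))))"
proof -
  define M where "M = Suc (expand J)"
  have dJ: "dir J = s" and wJ: "s * walk J = real k" and below: "\<And>i. i < J \<Longrightarrow> s * walk i < real k"
    using rec by (auto simp: record_at_def)
  have s: "s = 1 \<or> s = -1" using dir_cases[of J] dJ by simp
  have shrink_M: "shrink M = J" unfolding M_def by (rule shrink_Suc_expand)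
  have dM: "dir M = - s" unfolding M_def using dJ by (simp add: dir_first)
  have dN: "dir (Suc (expand M)) = s" using dM by (simp add: dir_first)
  have wN: "s * walk (Suc (expand M)) = real (Suc k)"
    using dN wJ s shrink_M by (auto simp: walk_Suc walk_expand algebra_simps)
  have early: "s * walk n < real (Suc k)" if n: "n < Suc (expand M)" for n
  proof (cases "n = 0")
    case True
    then show ?thesis by (simp add: walk_0)
  next
    case False
    then have pos: "0 < n" by simp
    let ?m = "shrink n" and ?j = "shrink (shrink n)"
    have "?m < M"
      using expand_shrink_less[OF pos] n shrink_eqI[of M n] le_shrink_iff[of M n]
      by (auto simp: M_def not_less[symmetric])
    then have mJ: "?m \<le> expand J" by (simp add: M_def)
    have small: "s * walk n \<le> s * walk ?j + 1"
      using walk_in_block[OF pos] dir_cases[of ?m] s by (auto simp: algebra_simps)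
    consider "?j < J" | "J \<le> ?j" by linarith
    then show ?thesis
    proof cases
      case 1
      \<comment> \<open>Positions are integers, so lying below \<open>k\<close> leaves room for a whole step.\<close>
      have "s * walk i \<in> \<int>" for i
      proof (induction i)
        case (Suc i)
        then show ?case using s dir_cases[of "Suc i"] by (auto simp: walk_Suc algebra_simps)
      qed (simp add: walk_0)
      then obtain z where z: "s * walk ?j = of_int z" by (auto elim: Ints_cases)
      with below[OF 1] have "z < int k" by linarith
      then have "s * walk ?j < real k" using z below[OF 1] by simp
      then show ?thesis using small by simp
    next
      case 2
      \<comment> \<open>Only block \<open>0\<close> remains, for \<open>J = 0\<close>; its first step goes against \<open>s\<close>.\<close>
      have "J = 0" using 2 mJ le_shrink_iff[of J ?m] by (cases "J = 0") auto
      then have "?m = 0" using mJ by simp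
      then show ?thesis
        using walk_in_block[OF pos] \<open>J = 0\<close> wJ dJ by (auto simp: walk_0)
    qed
  qed
  show ?thesis
    using dN wN early unfolding record_at_def M_def by blast
qed

lemma record_at_imp_R:
  assumes "record_at s k J" and "s * of_int v = real k"
  shows "walk J = of_int v" and "R v (sqrt 2) = J"
proof -
  have s: "s = 1 \<or> s = -1" using dir_cases[of J] assms(1) by (simp add: record_at_def)
  show attained: "walk J = of_int v" using assms s by (auto simp: record_at_def)
  show "R v (sqrt 2) = J"
    unfolding R_def
  proof (rule Least_equality)
    show "walk J = of_int v" by (rule attained)
    show "J \<le> N" if "walk N = of_int v" for N
      using assms that by (force simp: record_at_def not_less[symmetric])
  qed
qed

section \<open>The closed form\<close>

definition record_time :: "nat \<Rightarrow> nat" where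
  "record_time n = ((\<lambda>m. Suc (expand m)) ^^ n) 0"

lemma record_time_0 [simp]: "record_time 0 = 0"
  by (simp add: record_time_def)

lemma record_time_Suc: "record_time (Suc n) = Suc (expand (record_time n))"
  by (simp add: record_time_def)

lemma record_time_pos: "record_at 1 k (record_time (2 * k))"
proof (induction k)
  case 0
  show ?case by (simp add: record_at_def walk_0)
next
  case (Suc k)
  then show ?case using record_step[OF Suc] by (simp add: record_time_Suc)
qed

lemma record_time_neg: "record_at (-1) (Suc k) (record_time (Suc (2 * k)))"
proof (induction k)
  case 0
  have "dir (Suc 0) = -1" using dir_first[of 0] by simp
  then show ?case by (simp add: record_at_def record_time_Suc walk_Suc walk_0)
next
  case (Suc k)
  then show ?case using record_step[OF Suc] by (simp add: record_time_Suc)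
qed

text \<open>The rounding in \<^const>\<open>expand\<close> is resolved by \<open>shrink_Suc_expand\<close>, which says that
  \<^const>\<open>shrink\<close> leads from each member of the sequence back to its predecessor.\<close>

lemma record_time_rec:
  "record_time (Suc (Suc n)) = 2 * record_time (Suc n) + record_time n + 1"
  by (simp only: record_time_Suc shrink_Suc_expand expand_def[of "Suc _"])

lemma record_time_closed_form:
  "4 * real (record_time n) + 2 = (1 + sqrt 2) ^ Suc n + (1 - sqrt 2) ^ Suc n"
proof (induction n rule: induct_nat_012)
  case 0
  show ?case by simp
next
  case 1
  show ?case by (simp add: record_time_Suc algebra_simps)
next
  case (ge2 n)
  \<comment> \<open>Both bases are roots of \<open>x^2 = 2 * x + 1\<close>.\<close>
  have root: "x ^ Suc (Suc (Suc n)) = 2 * x ^ Suc (Suc n) + x ^ Suc n"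
    if "x * x = 2 * x + 1" for x :: real
  proof -
    have "x ^ Suc (Suc (Suc n)) = (x * x) * x ^ Suc n" by simp
    also have "\<dots> = 2 * x ^ Suc (Suc n) + x ^ Suc n" unfolding that by (simp add: algebra_simps)
    finally show ?thesis .
  qed
  have "(1 + sqrt 2) * (1 + sqrt 2) = 2 * (1 + sqrt 2) + (1::real)"
    and "(1 - sqrt 2) * (1 - sqrt 2) = 2 * (1 - sqrt 2) + (1::real)"
    by (simp_all add: algebra_simps)
  from root[OF this(1)] root[OF this(2)] ge2 show ?case
    unfolding record_time_rec by simp
qed

lemma conjugate_power_bounds: "(1 - sqrt 2) ^ Suc n < (1::real)" "- 1 < (1 - sqrt 2) ^ Suc n"
proof -
  have "\<bar>1 - sqrt 2\<bar> ^ Suc n < (1::real)"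
    using sqrt2_bounds by (intro power_Suc_less_one) auto
  then have "\<bar>(1 - sqrt 2) ^ Suc n\<bar> < (1::real)" by (simp only: power_abs)
  then show "(1 - sqrt 2) ^ Suc n < (1::real)" "- 1 < (1 - sqrt 2) ^ Suc n" by linarith+
qed

lemma floor_quarter_power: "\<lfloor>1 / 4 * (1 + sqrt 2) ^ Suc n\<rfloor> = int (record_time n)"
  using record_time_closed_form[of n] conjugate_power_bounds[of n]
  unfolding floor_eq_iff of_int_of_nat_eq by linarith

lemma record_time_odd_less: "4 * real (record_time (Suc (2 * k))) < (1 + sqrt 2) ^ (2 * Suc k)"
proof -
  have "4 * real (record_time (Suc (2 * k))) < (1 + sqrt 2) ^ Suc (Suc (2 * k))"
    using record_time_closed_form[of "Suc (2 * k)"] conjugate_power_bounds(1)[of "Suc (2 * k)"]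
    by linarith
  then show ?thesis by simp
qed

section \<open>Logarithmic growth along the records\<close>

text \<open>Since \<open>1.56 = 39 / 25\<close>, this says \<open>(1 + sqrt 2) ^ 39 < 4 ^ 25\<close>, for which the bound
  \<open>1 + sqrt 2 \<le> 2.42\<close> is sharp enough.\<close>

lemma ln_4_gt: "ln 4 > 1.56 * ln (1 + sqrt 2)"
proof -
  have "(1 + sqrt 2) ^ 39 \<le> (121 / 50 :: real) ^ 39"
    using sqrt2_bounds by (intro power_mono) auto
  also have "\<dots> < 4 ^ 25" by (simp add: power_divide)
  finally have "ln ((1 + sqrt 2) ^ 39) < ln (4 ^ 25 :: real)"
    by (subst ln_less_cancel_iff) (auto intro!: zero_less_power add_pos_pos)
  moreover have "ln ((1 + sqrt 2) ^ 39) = 39 * ln (1 + sqrt 2)"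
    by (simp add: ln_realpow add_pos_pos)
  moreover have "ln (4 ^ 25 :: real) = 25 * ln 4"
    by (subst ln_realpow) simp_all
  ultimately have "39 * ln (1 + sqrt 2) < 25 * ln (4::real)" by linarith
  then show ?thesis by simp
qed

theorem corollary4p6:
  shows "(\<forall>k::int. k \<noteq> 0 \<longrightarrow>
            (\<exists>N. S N (sqrt 2) = of_int k) \<and>
            int (R k (sqrt 2)) =
              (if k > 0 then \<lfloor>1 / 4 * (1 + sqrt 2) powi (2 * k + 1)\<rfloor>
               else \<lfloor>1 / 4 * (1 + sqrt 2) powi (- 2 * k)\<rfloor>)) \<and>
         infinite {N::nat. N > 0 \<and>
            \<bar>S N (sqrt 2)\<bar> > ln (4 * real N) / (2 * ln (1 + sqrt 2)) \<and>
            ln (4 * real N) / (2 * ln (1 + sqrt 2)) > ln (real N) / (2 * ln (1 + sqrt 2)) + 0.78}"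
    (is "?values \<and> infinite ?A")
proof
  show ?values
  proof (intro allI impI)
    fix k :: int
    assume "k \<noteq> 0"
    then consider (pos) n where "k = int n" "k > 0" | (neg) n where "k = - int (Suc n)"
      by (cases k) auto
    then show "(\<exists>N. S N (sqrt 2) = of_int k) \<and>
            int (R k (sqrt 2)) =
              (if k > 0 then \<lfloor>1 / 4 * (1 + sqrt 2) powi (2 * k + 1)\<rfloor>
               else \<lfloor>1 / 4 * (1 + sqrt 2) powi (- 2 * k)\<rfloor>)"
    proof cases
      case pos
      have e: "2 * k + 1 = int (Suc (2 * n))" using pos by simp
      have "walk (record_time (2 * n)) = of_int k" "R k (sqrt 2) = record_time (2 * n)"
        using record_at_imp_R[OF record_time_pos[of n], of k] pos by simp_all
      then show ?thesis using pos(2) floor_quarter_power[of "2 * n"]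
        unfolding e power_int_of_nat by auto
    next
      case neg
      have e: "- 2 * k = int (Suc (Suc (2 * n)))" using neg by simp
      have "walk (record_time (Suc (2 * n))) = of_int k" "R k (sqrt 2) = record_time (Suc (2 * n))"
        using record_at_imp_R[OF record_time_neg[of n], of k] neg by simp_all
      moreover have "\<not> k > 0" using neg by simp
      ultimately show ?thesis using floor_quarter_power[of "Suc (2 * n)"]
        unfolding e power_int_of_nat by auto
    qed
  qed
next
  let ?f = "\<lambda>k. record_time (Suc (2 * k))"
  have w: "walk (?f k) = - real (Suc k)" for k
    using record_time_neg[of k] by (simp add: record_at_def)
  have "inj ?f"
  proof (rule injI)
    fix i j
    assume "?f i = ?f j"
    then have "- real (Suc i) = - real (Suc j)" using w[of i] w[of j] by metis
    then show "i = j" by simp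
  qed
  moreover have "range ?f \<subseteq> ?A"
  proof clarify
    fix k
    let ?N = "?f k" and ?L = "ln (1 + sqrt 2)"
    have N: "?N > 0" by (simp add: record_time_Suc)
    have L: "?L > 0" by (rule ln_gt_zero) simp
    have "ln (4 * real ?N) < ln ((1 + sqrt 2) ^ (2 * Suc k))"
      using record_time_odd_less[of k] N by (subst ln_less_cancel_iff) (auto simp: add_pos_pos)
    also have "\<dots> = real (Suc k) * (2 * ?L)"
      by (simp add: ln_realpow add_pos_pos del: power_Suc mult_Suc_right)
    finally have "ln (4 * real ?N) / (2 * ?L) < real (Suc k)"
      using L by (simp add: divide_less_eq del: of_nat_Suc)
    moreover have "ln (real ?N) / (2 * ?L) + 0.78 < ln (4 * real ?N) / (2 * ?L)"
    proof -
      have "ln (4 * real ?N) = ln 4 + ln (real ?N)" using N by (simp add: ln_mult)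
      moreover have "0.78 < ln 4 / (2 * ?L)"
        using ln_4_gt L by (simp add: less_divide_eq)
      ultimately show ?thesis by (simp add: add_divide_distrib)
    qed
    ultimately show "?N > 0 \<and> \<bar>walk ?N\<bar> > ln (4 * real ?N) / (2 * ?L) \<and>
        ln (4 * real ?N) / (2 * ?L) > ln (real ?N) / (2 * ?L) + 0.78"
      using N w[of k] by simp
  qed
  ultimately show "infinite ?A"
    unfolding infinite_iff_countable_subset by blast
qed

end
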